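(* Let $(\kappa_n)$ be a graphical sequence of kernels on a vertex space $\mathcal V$ with limit $\kappa$, and assume that $\kappa$ is critical, i.e. $\|T_\kappa\|=1$. Then $$\frac1n e\bigl(G^{\mathcal V}(n,\kappa_n)\bigr)\xrightarrow{p}\frac12\iint_{\mathcal S^2}\kappa(x,y)\,d\mu(x)d\mu(y)\le\frac12,$$ with equality in the uniform case $\kappa=1$; more precisely, equality holds if and only if $\int_{\mathcal S}\kappa(x,y)\,d\mu(y)=1$ for a.e. $x$.
   Context: A ground space is a pair $(\mathcal S,\mu)$, where $\mathcal S$ is a separable metric space and $\mu$ is a Borel probability measure on $\mathcal S$. A $\mu$-continuity set is a Borel set $A\subseteq\mathcal S$ with $\mu(\partial A)=0$. A vertex space is a triple $\mathcal V=(\mathcal S,\mu,(\mathbf x_n))$, where $(\mathcal S,\mu)$ is a ground space and, for each $n$ in an infinite set of positive integers, $\mathbf x_n=(x_1,\dots,x_n)$ is a random sequence of $n$ points of $\mathcal S$ (the $x_i$ depend on $n$), such that $\#\{i:x_i\in A\}/n\xrightarrow{p}\mu(A)$ as $n\to\infty$ for every $\mu$-continuity set $A$. A kernel on $\mathcal V$ is a symmetric non-negative Borel measurable function on $\mathcal S\times\mathcal S$. For a kernel $\kappa$, $G^{\mathcal V}(n,\kappa)$ is the random graph on $\{1,\dots,n\}$ in which, given $\mathbf x_n$, each possible edge $ij$, $i<j$, is present with probability $\min\{\kappa(x_i,x_j)/n,1\}$, independently of the others. $e(G)$ is the number of edges of $G$. A sequence $(\kappa_n)$ of kernels on $\mathcal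 V$ is graphical on $\mathcal V$ with limit $\kappa$ (a kernel) if: for a.e. $(y,z)\in\mathcal S^2$, $y_n\to y$ and $z_n\to z$ imply $\kappa_n(y_n,z_n)\to\kappa(y,z)$; $\kappa$ is continuous a.e. on $\mathcal S\times\mathcal S$; $\kappa\in L^1(\mathcal S\times\mathcal S,\mu\times\mu)$; and $\frac1n\mathbb E\,e(G^{\mathcal V}(n,\kappa_n))\to\frac12\iint_{\mathcal S^2}\kappa\,d\mu\,d\mu$. $(T_\kappa f)(x)=\int_{\mathcal S}\kappa(x,y)f(y)\,d\mu(y)$ and $\|T_\kappa\|=\sup\{\|T_\kappa f\|_{L^2(\mu)}: f\ge0,\ \|f\|_{L^2(\mu)}\le1\}$. *)

theory Defs
  imports "HOL-Probability.Probability"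
begin

text \<open>
  The metric space is a type of class \<^class>\<open>metric_space\<close>; for metric spaces
  \<^class>\<open>second_countable_topology\<close> is the same as separability.
\<close>

locale ground_space = prob_space \<mu>
  for \<mu> :: "'a::{metric_space, second_countable_topology} measure" +
  assumes sets_eq_borel: "sets \<mu> = sets borel"

definition continuity_set :: "'a::metric_space measure \<Rightarrow> 'a set \<Rightarrow> bool" where
  "continuity_set \<mu> A \<longleftrightarrow> A \<in> sets borel \<and> measure \<mu> (frontier A) = 0"

text \<open>
  Everything is indexed by the elements of an infinite set \<open>I\<close> of positive integers, and
  \<open>n \<rightarrow> \<infinity>\<close> means \<open>n \<rightarrow> \<infinity>\<close> along \<open>I\<close>.
\<close>

definition at_infinity_in :: "nat set \<Rightarrow> nat filter" where
  "at_infinity_in I = inf sequentially (principal I)"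

text \<open>
  Convergence in probability to a constant: the \<open>X n\<close> may live on different probability
  spaces \<open>P n\<close>.
\<close>

definition tendsto_in_prob ::
    "nat set \<Rightarrow> (nat \<Rightarrow> 'w measure) \<Rightarrow> (nat \<Rightarrow> 'w \<Rightarrow> real) \<Rightarrow> real \<Rightarrow> bool" where
  "tendsto_in_prob I P X c \<longleftrightarrow>
    (\<forall>\<epsilon>>0. ((\<lambda>n. measure (P n) {\<omega> \<in> space (P n). \<epsilon> < \<bar>X n \<omega> - c\<bar>}) \<longlongrightarrow> 0)
              (at_infinity_in I))"

text \<open>
  \<open>x n i\<close> is the \<open>i\<close>-th point of the \<open>n\<close>-th random sequence, a random element
  on the probability space \<open>P n\<close>; only \<open>n \<in> I\<close> and \<open>1 \<le> i \<le> n\<close> matter.  Nothing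
  is assumed about the joint law of the \<open>x n i\<close> for fixed \<open>n\<close> or for different \<open>n\<close>.
\<close>

locale vertex_space = ground_space \<mu>
  for \<mu> :: "'a::{metric_space, second_countable_topology} measure" +
  fixes I :: "nat set"
    and P :: "nat \<Rightarrow> 'w measure"
    and x :: "nat \<Rightarrow> nat \<Rightarrow> 'w \<Rightarrow> 'a"
  assumes infinite_index: "infinite I"
    and index_pos: "n \<in> I \<Longrightarrow> 0 < n"
    and prob_space_P: "n \<in> I \<Longrightarrow> prob_space (P n)"
    and random_points: "n \<in> I \<Longrightarrow> i \<in> {1..n} \<Longrightarrow> x n i \<in> measurable (P n) borel"
    and empirical_tendsto:
      "continuity_set \<mu> A \<Longrightarrow>
        tendsto_in_prob I P (\<lambda>n \<omega>. real (card {i \<in> {1..n}. x n i \<omega> \<in> A}) / real n) (measure \<mu> A)"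

definition is_kernel :: "('a::metric_space \<Rightarrow> 'a \<Rightarrow> real) \<Rightarrow> bool" where
  "is_kernel \<kappa> \<longleftrightarrow>
    (\<forall>y z. \<kappa> y z = \<kappa> z y) \<and> (\<forall>y z. 0 \<le> \<kappa> y z) \<and>
    (\<lambda>(y, z). \<kappa> y z) \<in> borel_measurable borel"

text \<open>
  A graph on \<open>{1..n}\<close> is represented by its edge set, the edge \<open>ij\<close> with \<open>i < j\<close> being the
  pair \<open>(i, j)\<close>; the number of edges is then the cardinality.
\<close>

definition possible_edges :: "nat \<Rightarrow> (nat \<times> nat) set" where
  "possible_edges n = {(i, j). 1 \<le> i \<and> i < j \<and> j \<le> n}"

text \<open>The conditional law of the graph given the points \<open>s 1, \<dots>, s n\<close>.\<close>

definition graph_pmf ::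
    "nat \<Rightarrow> ('a \<Rightarrow> 'a \<Rightarrow> real) \<Rightarrow> (nat \<Rightarrow> 'a) \<Rightarrow> (nat \<times> nat) set pmf" where
  "graph_pmf n \<kappa> s =
    map_pmf (\<lambda>b. {e \<in> possible_edges n. b e})
      (Pi_pmf (possible_edges n) False
        (\<lambda>(i, j). bernoulli_pmf (min (\<kappa> (s i) (s j) / real n) 1)))"

text \<open>
  The law of \<open>G\<^sup>V(n, \<kappa>)\<close>: the mixture of the conditional laws over the random points.
\<close>

definition random_graph ::
    "(nat \<Rightarrow> 'w measure) \<Rightarrow> (nat \<Rightarrow> nat \<Rightarrow> 'w \<Rightarrow> 'a) \<Rightarrow> nat \<Rightarrow> ('a \<Rightarrow> 'a \<Rightarrow> real)
      \<Rightarrow> (nat \<times> nat) set measure" where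
  "random_graph P x n \<kappa> = P n \<bind> (\<lambda>\<omega>. measure_pmf (graph_pmf n \<kappa> (\<lambda>i. x n i \<omega>)))"

definition kernel_integral :: "'a measure \<Rightarrow> ('a \<Rightarrow> 'a \<Rightarrow> real) \<Rightarrow> real" where
  "kernel_integral \<mu> \<kappa> = (LINT (y, z)|(\<mu> \<Otimes>\<^sub>M \<mu>). \<kappa> y z)"

definition graphical ::
    "'a::{metric_space, second_countable_topology} measure \<Rightarrow> nat set \<Rightarrow> (nat \<Rightarrow> 'w measure)
      \<Rightarrow> (nat \<Rightarrow> nat \<Rightarrow> 'w \<Rightarrow> 'a) \<Rightarrow> (nat \<Rightarrow> 'a \<Rightarrow> 'a \<Rightarrow> real) \<Rightarrow> ('a \<Rightarrow> 'a \<Rightarrow> real) \<Rightarrow> bool" where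
  "graphical \<mu> I P x \<kappa>s \<kappa> \<longleftrightarrow>
    (\<forall>n\<in>I. is_kernel (\<kappa>s n)) \<and> is_kernel \<kappa> \<and>
    (AE (y, z) in \<mu> \<Otimes>\<^sub>M \<mu>. \<forall>ys zs.
        (ys \<longlongrightarrow> y) (at_infinity_in I) \<longrightarrow> (zs \<longlongrightarrow> z) (at_infinity_in I) \<longrightarrow>
        ((\<lambda>n. \<kappa>s n (ys n) (zs n)) \<longlongrightarrow> \<kappa> y z) (at_infinity_in I)) \<and>
    (AE p in \<mu> \<Otimes>\<^sub>M \<mu>. isCont (\<lambda>(y, z). \<kappa> y z) p) \<and>
    integrable (\<mu> \<Otimes>\<^sub>M \<mu>) (\<lambda>(y, z). \<kappa> y z) \<and>
    ((\<lambda>n. (LINT G|random_graph P x n (\<kappa>s n). real (card G)) / real n)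
        \<longlongrightarrow> kernel_integral \<mu> \<kappa> / 2) (at_infinity_in I)"

text \<open>
  For \<open>f \<ge> 0\<close>, both \<open>T f\<close> and the operator norm may be infinite, hence the values in
  \<^typ>\<open>ennreal\<close>.
\<close>

definition T_op :: "'a measure \<Rightarrow> ('a \<Rightarrow> 'a \<Rightarrow> real) \<Rightarrow> ('a \<Rightarrow> real) \<Rightarrow> 'a \<Rightarrow> ennreal" where
  "T_op \<mu> \<kappa> f y = (\<integral>\<^sup>+ z. ennreal (\<kappa> y z * f z) \<partial>\<mu>)"

definition L2_norm :: "'a measure \<Rightarrow> ('a \<Rightarrow> ennreal) \<Rightarrow> ennreal" where
  "L2_norm \<mu> g =
    (let s = (\<integral>\<^sup>+ y. (g y)\<^sup>2 \<partial>\<mu>) in if s = \<infinity> then \<infinity> else ennreal (sqrt (enn2real s)))"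

definition T_norm :: "'a measure \<Rightarrow> ('a \<Rightarrow> 'a \<Rightarrow> real) \<Rightarrow> ennreal" where
  "T_norm \<mu> \<kappa> = Sup {L2_norm \<mu> (T_op \<mu> \<kappa> f) | f.
     f \<in> borel_measurable \<mu> \<and> (\<forall>y. 0 \<le> f y) \<and> L2_norm \<mu> (\<lambda>y. ennreal (f y)) \<le> 1}"

definition critical :: "'a measure \<Rightarrow> ('a \<Rightarrow> 'a \<Rightarrow> real) \<Rightarrow> bool" where
  "critical \<mu> \<kappa> \<longleftrightarrow> T_norm \<mu> \<kappa> = 1"

end

theory Submission
  imports Defs
begin

text \<open>
  The number of edges converges in mean by hypothesis, so for convergence in probability it is
  enough that \<open>e(G) / n < a\<close> has vanishing probability for every \<open>a\<close> below the limit: an upper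
  deviation would have to be compensated by a lower one.

  For the lower tail, cut the space into countably many continuity sets of diameter less than
  \<open>1 / (m + 1)\<close> and let \<open>h\<^sub>m\<close> be the step function whose value on a product of two cells is
  the infimum there of all \<open>\<kappa>\<^sub>n\<close> with \<open>n \<ge> m\<close>, truncated at \<open>m\<close>.  The continuity condition gives
  \<open>liminf h\<^sub>m \<ge> \<kappa>\<close> almost everywhere, so by Fatou some \<open>h\<^sub>m\<close>, restricted to finitely many
  cells, has integral close to that of \<open>\<kappa>\<close>.  The empirical measures of these cells converge,
  hence the conditional mean of \<open>e(G) / n\<close> is asymptotically bounded below, and a Chernoff bound
  for sums of independent Bernoulli variables transfers this to \<open>e(G) / n\<close>.

  For the inequality, test the operator norm on the constant function: if \<open>g = T 1\<close>, then
  \<open>\<integral> g\<^sup>2 \<le> 1\<close>, so \<open>0 \<le> \<integral> (g - 1)\<^sup>2 \<le> 2 - 2 \<integral> g\<close>.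
\<close>

section \<open>Step functions below the kernels\<close>

lemma (in ground_space) space_eq_UNIV: "space \<mu> = UNIV"
  using sets_eq_imp_space_eq[OF sets_eq_borel] by simp

lemma (in ground_space) continuity_set_Int:
  assumes "continuity_set \<mu> A" "continuity_set \<mu> B"
  shows "continuity_set \<mu> (A \<inter> B)"
proof -
  have "measure \<mu> (frontier (A \<inter> B)) \<le> measure \<mu> (frontier A \<union> frontier B)"
    by (intro finite_measure_mono frontier_Int_subset) (simp add: sets_eq_borel)
  also have "\<dots> \<le> measure \<mu> (frontier A) + measure \<mu> (frontier B)"
    by (intro measure_Un_le) (simp_all add: sets_eq_borel)
  finally show ?thesis
    using assms by (auto simp: continuity_set_def measure_le_0_iff)
qed

lemma continuity_set_Compl:
  "continuity_set \<mu> A \<Longrightarrow> continuity_set \<mu> (- A)"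
  by (auto simp: continuity_set_def frontier_complement)

text \<open>The frontier of a ball about \<open>d\<close> lies in the sphere of the same radius. A
  sphere with positive mass is an atom of the law of the distance to \<open>d\<close>. A probability
  law on the reals has only countably many atoms, while an interval contains uncountably many
  radii.\<close>

lemma (in ground_space) exists_continuity_ball:
  assumes "0 \<le> a" "a < b"
  shows "\<exists>s>a. s < b \<and> continuity_set \<mu> (ball d s)"
proof -
  define N where "N = distr \<mu> borel (dist d)"
  have "dist d \<in> borel_measurable borel"
    by (intro borel_measurable_continuous_onI continuous_intros)
  then have [measurable]: "dist d \<in> borel_measurable \<mu>"
    using measurable_cong_sets[OF sets_eq_borel refl] by blast
  interpret N: prob_space N
    unfolding N_def by (rule prob_space_distr) simp
  have "uncountable ({a<..<b} - {s. measure N {s} \<noteq> 0})"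
    using assms N.countable_support by (intro uncountable_minus_countable) (auto simp: uncountable_open_interval)
  then have "{a<..<b} - {s. measure N {s} \<noteq> 0} \<noteq> {}"
    by (metis countable_empty)
  then obtain s where s: "a < s" "s < b" "measure N {s} = 0"
    by auto
  have "measure \<mu> (frontier (ball d s)) \<le> measure \<mu> (dist d -` {s} \<inter> space \<mu>)"
  proof (rule finite_measure_mono)
    show "frontier (ball d s) \<subseteq> dist d -` {s} \<inter> space \<mu>"
      using closure_minimal[OF ball_subset_cball closed_cball, of d s]
      by (auto simp: frontier_def interior_open space_eq_UNIV not_less)
  qed simp
  also have "\<dots> = 0"
    using s by (simp add: N_def measure_distr)
  finally show ?thesis
    using s by (auto simp: continuity_set_def measure_le_0_iff)
qed

text \<open>Cover the space by countably many small continuity balls and send each point to the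
  first ball that contains it. A cell arises from finitely many balls by complements and
  intersections, so it is again a continuity set. The partition is encoded by its labelling
  \<open>q\<close>.\<close>

lemma (in ground_space) exists_fine_continuity_partition:
  assumes "0 < r"
  obtains q :: "'a \<Rightarrow> nat"
    where "\<And>k. continuity_set \<mu> {y. q y = k}" "\<And>y y'. q y = q y' \<Longrightarrow> dist y y' < r"
proof -
  obtain D :: "'a set" where D: "countable D" "\<And>X. open X \<Longrightarrow> X \<noteq> {} \<Longrightarrow> \<exists>d\<in>D. d \<in> X"
    using countable_dense_setE by blast
  have "D \<noteq> {}" using D(2)[of UNIV] by auto
  \<comment> \<open>Radii above \<open>r / 4\<close> make the balls about a dense set cover
    everything; radii below \<open>r / 2\<close> keep the diameters below \<open>r\<close>.\<close>
  have "\<forall>e. \<exists>s>r / 4. s < r / 2 \<and> continuity_set \<mu> (ball e s)"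
    using exists_continuity_ball[of "r / 4" "r / 2"] assms by simp
  then obtain s where s: "\<And>e. r / 4 < s e" "\<And>e. s e < r / 2" "\<And>e. continuity_set \<mu> (ball e (s e))"
    by metis
  \<comment> \<open>The enumeration may repeat elements of \<open>D\<close>, for instance if
    \<open>D\<close> is finite; a repeated ball merely yields an empty cell.\<close>
  define B where "B = (\<lambda>k. ball (from_nat_into D k) (s (from_nat_into D k)))"
  have cover: "\<exists>k. y \<in> B k" for y
  proof -
    obtain d where "d \<in> D" "d \<in> ball y (r / 4)"
      using D(2)[of "ball y (r / 4)"] assms by auto
    moreover then obtain k where "d = from_nat_into D k"
      using D(1) by (metis from_nat_into_surj)
    ultimately show ?thesis
      using s(1)[of d] by (auto simp: B_def dist_commute intro!: exI[of _ k])
  qed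
  define q where "q = (\<lambda>y. LEAST k. y \<in> B k)"
  have qB: "y \<in> B (q y)" for y
    unfolding q_def using cover[of y] by (auto intro: LeastI_ex)
  have q_eq: "q y = k \<longleftrightarrow> y \<in> B k \<and> (\<forall>j<k. y \<notin> B j)" for y k
  proof
    assume "q y = k"
    then show "y \<in> B k \<and> (\<forall>j<k. y \<notin> B j)"
      using qB not_less_Least unfolding q_def by blast
  next
    assume "y \<in> B k \<and> (\<forall>j<k. y \<notin> B j)"
    then show "q y = k"
      unfolding q_def by (intro Least_equality) (auto simp: not_less[symmetric])
  qed
  have less: "continuity_set \<mu> {y. \<forall>j<k. y \<notin> B j}" for k
  proof (induction k)
    case 0
    then show ?case by (simp add: continuity_set_def)
  next
    case (Suc k)
    have "continuity_set \<mu> ({y. \<forall>j<k. y \<notin> B j} \<inter> - B k)"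
      using s(3) by (intro continuity_set_Int Suc continuity_set_Compl) (simp add: B_def)
    also have "{y. \<forall>j<k. y \<notin> B j} \<inter> - B k = {y. \<forall>j<Suc k. y \<notin> B j}"
      by (auto simp: less_Suc_eq)
    finally show ?case .
  qed
  show ?thesis
  proof
    fix k
    have "continuity_set \<mu> (B k \<inter> {y. \<forall>j<k. y \<notin> B j})"
      using s(3) by (intro continuity_set_Int less) (simp add: B_def)
    then show "continuity_set \<mu> {y. q y = k}"
      by (simp add: q_eq Int_def)
  next
    fix y y' assume "q y = q y'"
    then have "y \<in> B (q y)" "y' \<in> B (q y)" using qB by metis+
    then show "dist y y' < r"
      using s(2)[of "from_nat_into D (q y)"] dist_triangle_half_r[of "from_nat_into D (q y)" y r y']
      by (simp add: B_def)
  qed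
qed

section \<open>Locally uniform lower bounds and Fatou's lemma\<close>

text \<open>Turns the sequential continuity condition into a bound that is uniform in
  \<open>n\<close> and on neighbourhoods. If it failed at every scale, the offending points could be
  strung together into sequences tending to \<open>y\<close> and \<open>z\<close> along which
  infinitely many kernel values stay below \<open>l < L\<close>.\<close>

lemma kernels_ge_near:
  fixes \<kappa>s :: "nat \<Rightarrow> 'a::metric_space \<Rightarrow> 'b::metric_space \<Rightarrow> real"
  assumes conv: "\<And>ys zs. (ys \<longlongrightarrow> y) (at_infinity_in I) \<Longrightarrow> (zs \<longlongrightarrow> z) (at_infinity_in I) \<Longrightarrow>
        ((\<lambda>n. \<kappa>s n (ys n) (zs n)) \<longlongrightarrow> L) (at_infinity_in I)"
    and "l < L"
  shows "\<exists>N. \<forall>n\<in>I. n \<ge> N \<longrightarrow> (\<forall>y' z'. dist y y' < 1 / real (Suc N) \<longrightarrow> dist z z' < 1 / real (Suc N) \<longrightarrow> l \<le> \<kappa>s n y' z')"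
proof (rule ccontr)
  assume neg: "\<not> ?thesis"
  then have "\<forall>N. \<exists>n y' z'. n \<in> I \<and> n \<ge> N \<and> dist y y' < 1 / real (Suc N) \<and> dist z z' < 1 / real (Suc N) \<and> \<kappa>s n y' z' < l"
    by (simp add: not_le) blast
  then obtain f v w where f: "\<And>N. f N \<in> I" "\<And>N. N \<le> f N" "\<And>N. dist y (v N) < 1 / real (Suc N)"
    "\<And>N. dist z (w N) < 1 / real (Suc N)" "\<And>N. \<kappa>s (f N) (v N) (w N) < l"
    by metis
  \<comment> \<open>The offending indices \<open>f N\<close> may coincide. Along \<open>r\<close>
    the indices \<open>f (r k)\<close> increase strictly, so each \<open>n\<close> receives at most
    one offending pair.\<close>
  obtain r :: "nat \<Rightarrow> nat" where r: "strict_mono r" "\<And>k. f (r k) < r (Suc k)"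
  proof -
    have "\<exists>r. \<forall>k. r k < r (Suc k) \<and> f (r k) < r (Suc k)"
      using dependent_nat_choice[of "\<lambda>_ _. True" "\<lambda>_ a b. a < b \<and> f a < b"]
      by (metis (no_types, opaque_lifting) less_Suc_eq_le max.cobounded1 max.cobounded2)
    then show ?thesis using that by (auto simp: strict_mono_Suc_iff)
  qed
  define g where "g = f \<circ> r"
  have g: "strict_mono g"
    unfolding strict_mono_Suc_iff g_def using r(2) f(2) by (auto intro: less_le_trans)
  define j where "j = inv g"
  have j: "j (g k) = k" for k
    unfolding j_def using g by (simp add: strict_mono_imp_inj_on)
  \<comment> \<open>The condition speaks of sequences indexed by all \<open>n\<close>: off the range
    of \<open>g\<close> they are filled with the limit point itself.\<close>
  have lim: "((\<lambda>n. if n \<in> range g then u (r (j n)) else a) \<longlongrightarrow> a) (at_infinity_in I)"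
    if u: "\<And>N. dist a (u N) < 1 / real (Suc N)" for u and a :: "'c::metric_space"
  proof (rule tendstoI)
    fix e :: real assume "0 < e"
    then obtain k where k: "1 / real (Suc k) < e"
      using nat_approx_posE by blast
    have "\<forall>\<^sub>F n in sequentially. dist (if n \<in> range g then u (r (j n)) else a) a < e"
    proof (rule eventually_sequentiallyI[of "g k"])
      fix n assume n: "g k \<le> n"
      show "dist (if n \<in> range g then u (r (j n)) else a) a < e"
      proof (cases "n \<in> range g")
        case True
        then obtain i where i: "n = g i" by auto
        with n g have "k \<le> i" by (simp add: strict_mono_less_eq)
        also have "i \<le> r i" using r(1) by (rule strict_mono_imp_increasing)
        finally have "1 / real (Suc (r i)) \<le> 1 / real (Suc k)" by (simp add: field_simps)
        with u[of "r i"] k show ?thesis by (simp add: i j dist_commute)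
      qed (simp add: \<open>0 < e\<close>)
    qed
    then show "\<forall>\<^sub>F n in at_infinity_in I. dist (if n \<in> range g then u (r (j n)) else a) a < e"
      unfolding at_infinity_in_def by (rule filter_leD[rotated]) simp
  qed
  have "\<forall>\<^sub>F n in at_infinity_in I. l < \<kappa>s n (if n \<in> range g then v (r (j n)) else y) (if n \<in> range g then w (r (j n)) else z)"
    using conv[OF lim[of y v, OF f(3)] lim[of z w, OF f(4)]] \<open>l < L\<close> by (rule order_tendstoD)
  then obtain N where N: "\<And>n. n \<in> I \<Longrightarrow> N \<le> n \<Longrightarrow> l < \<kappa>s n (if n \<in> range g then v (r (j n)) else y) (if n \<in> range g then w (r (j n)) else z)"
    unfolding at_infinity_in_def eventually_inf_principal eventually_sequentially by blast
  have "g N \<in> I" "N \<le> g N"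
    using f(1) strict_mono_imp_increasing[OF g] by (simp_all add: g_def)
  from N[OF this] have "l < \<kappa>s (g N) (v (r N)) (w (r N))"
    by (simp add: j)
  with f(5)[of "r N"] show False by (simp add: g_def)
qed

text \<open>Fatou's lemma, since \<open>ae\<close> says \<open>f \<le> liminf u\<close> almost
  everywhere. It serves twice below: to pass from the limit kernel to a step function, and from
  there to finitely many cells.\<close>

lemma exists_nn_integral_greater:
  fixes u :: "nat \<Rightarrow> 'b \<Rightarrow> ennreal"
  assumes u: "\<And>n. u n \<in> borel_measurable M"
    and ae: "AE w in M. \<forall>l < f w. \<forall>\<^sub>F n in sequentially. l < u n w"
    and a: "a < (\<integral>\<^sup>+ w. f w \<partial>M)"
  shows "\<exists>n. a < (\<integral>\<^sup>+ w. u n w \<partial>M)"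
proof -
  have "(\<integral>\<^sup>+ w. f w \<partial>M) \<le> (\<integral>\<^sup>+ w. liminf (\<lambda>n. u n w) \<partial>M)"
    using ae by (intro nn_integral_mono_AE) (simp add: le_Liminf_iff)
  also have "\<dots> \<le> liminf (\<lambda>n. integral\<^sup>N M (u n))"
    by (rule nn_integral_liminf[OF u])
  finally have "a < liminf (\<lambda>n. integral\<^sup>N M (u n))"
    using a by (rule less_le_trans[rotated])
  then have "\<forall>\<^sub>F n in sequentially. a < integral\<^sup>N M (u n)"
    by (rule less_LiminfD)
  then show ?thesis
    by (auto simp: eventually_sequentially)
qed

text \<open>One step function lies below all kernels with \<open>n \<ge> m\<close>, so a single
  finite family of cells serves all large \<open>n\<close>. The bound
  \<open>c i j \<le> real m\<close> will later control the diagonal terms, the truncation of edge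
  probabilities at 1 and the error from replacing measures of cells by frequencies.\<close>

lemma (in ground_space) exists_step_minorant:
  fixes \<kappa>s :: "nat \<Rightarrow> 'a \<Rightarrow> 'a \<Rightarrow> real" and \<kappa> :: "'a \<Rightarrow> 'a \<Rightarrow> real"
  assumes nn: "\<forall>n\<in>I. \<forall>y z. 0 \<le> \<kappa>s n y z"
    and conv: "AE (y, z) in \<mu> \<Otimes>\<^sub>M \<mu>. \<forall>ys zs.
        (ys \<longlongrightarrow> y) (at_infinity_in I) \<longrightarrow> (zs \<longlongrightarrow> z) (at_infinity_in I) \<longrightarrow>
        ((\<lambda>n. \<kappa>s n (ys n) (zs n)) \<longlongrightarrow> \<kappa> y z) (at_infinity_in I)"
    and int: "integrable (\<mu> \<Otimes>\<^sub>M \<mu>) (\<lambda>(y, z). \<kappa> y z)"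
    and \<kappa>_nn: "\<And>y z. 0 \<le> \<kappa> y z"
    and a: "0 \<le> a" "a < kernel_integral \<mu> \<kappa>"
  obtains q :: "'a \<Rightarrow> nat" and c :: "nat \<Rightarrow> nat \<Rightarrow> real" and m K :: nat
  where "\<And>k. continuity_set \<mu> {y. q y = k}"
    and "\<And>i j. 0 \<le> c i j" and "\<And>i j. c i j \<le> real m"
    and "\<And>n y z. n \<in> I \<Longrightarrow> m \<le> n \<Longrightarrow> c (q y) (q z) \<le> \<kappa>s n y z"
    and "a < (\<Sum>i<K. \<Sum>j<K. c i j * (measure \<mu> {y. q y = i} * measure \<mu> {y. q y = j}))"
proof -
  interpret pair: pair_prob_space \<mu> \<mu> ..
  have "\<exists>q :: 'a \<Rightarrow> nat. (\<forall>k. continuity_set \<mu> {y. q y = k}) \<and> (\<forall>y y'. q y = q y' \<longrightarrow> dist y y' < 1 / real (Suc m))" for m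
    using exists_fine_continuity_partition[of "1 / real (Suc m)"] by (metis of_nat_0_less_iff zero_less_Suc zero_less_divide_1_iff)
  then obtain q :: "nat \<Rightarrow> 'a \<Rightarrow> nat" where q: "\<And>m k. continuity_set \<mu> {y. q m y = k}"
    "\<And>m y y'. q m y = q m y' \<Longrightarrow> dist y y' < 1 / real (Suc m)"
    by metis
  have cell_sets: "{y. q m y = k} \<in> sets \<mu>" for m k
    using q(1)[of m k] by (simp add: continuity_set_def sets_eq_borel)
  have q_meas [measurable]: "q m \<in> measurable \<mu> (count_space UNIV)" for m
    using cell_sets by (auto simp: measurable_count_space_eq2_countable space_eq_UNIV vimage_def)
  define V where "V = (\<lambda>m i j. {\<kappa>s n y z | n y z. n \<in> I \<and> m \<le> n \<and> q m y = i \<and> q m z = j})"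
  \<comment> \<open>Inserting \<open>real m\<close> both truncates and keeps the set nonempty when a cell is empty.\<close>
  define c where "c = (\<lambda>m i j. Inf (insert (real m) (V m i j)))"
  have bdd: "bdd_below (insert (real m) (V m i j))" for m i j
    by (rule bdd_belowI[of _ 0]) (auto simp: V_def nn)
  have c_nn: "0 \<le> c m i j" for m i j
    unfolding c_def by (rule cInf_greatest) (auto simp: V_def nn)
  have c_le: "c m i j \<le> real m" for m i j
    unfolding c_def by (rule cInf_lower[OF _ bdd]) simp
  have c_le_\<kappa>: "c m (q m y) (q m z) \<le> \<kappa>s n y z" if "n \<in> I" "m \<le> n" for m n y z
    unfolding c_def by (rule cInf_lower[OF _ bdd]) (use that in \<open>auto simp: V_def\<close>)
  have c_ge: "\<forall>\<^sub>F m in sequentially. l \<le> c m (q m y) (q m z)"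
    if N: "\<And>n y' z'. n \<in> I \<Longrightarrow> N \<le> n \<Longrightarrow> dist y y' < 1 / real (Suc N) \<Longrightarrow> dist z z' < 1 / real (Suc N) \<Longrightarrow> l \<le> \<kappa>s n y' z'"
    for N l y z
  proof (rule eventually_sequentiallyI)
    \<comment> \<open>\<open>m \<ge> N\<close> places the cells of \<open>y\<close> and
      \<open>z\<close> inside the balls where \<open>N\<close> gives the bound;
      \<open>m \<ge> l\<close> makes the truncation level harmless.\<close>
    fix m assume m: "max N (nat \<lceil>l\<rceil>) \<le> m"
    show "l \<le> c m (q m y) (q m z)"
      unfolding c_def
    proof (rule cInf_greatest)
      fix v assume "v \<in> insert (real m) (V m (q m y) (q m z))"
      then consider "v = real m" | n y' z' where "v = \<kappa>s n y' z'" "n \<in> I" "m \<le> n" "q m y = q m y'" "q m z = q m z'"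
        by (auto simp: V_def)
      then show "l \<le> v"
      proof cases
        case 1
        then show ?thesis using m by linarith
      next
        case 2
        have "1 / real (Suc m) \<le> 1 / real (Suc N)" using m by (simp add: field_simps)
        then show ?thesis using 2 m q(2)[of m y y'] q(2)[of m z z'] N[of n y' z'] by fastforce
      qed
    qed simp
  qed
  define h where "h = (\<lambda>m (y, z). ennreal (c m (q m y) (q m z)))"
  have h_meas [measurable]: "h m \<in> borel_measurable (\<mu> \<Otimes>\<^sub>M \<mu>)" for m
    unfolding h_def by measurable
  have int_eq: "ennreal (kernel_integral \<mu> \<kappa>) = (\<integral>\<^sup>+ (y, z). ennreal (\<kappa> y z) \<partial>(\<mu> \<Otimes>\<^sub>M \<mu>))"
    unfolding kernel_integral_def using nn_integral_eq_integral[OF int] \<kappa>_nn by (simp add: case_prod_unfold)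
  have "AE w in \<mu> \<Otimes>\<^sub>M \<mu>. \<forall>l < (case w of (y, z) \<Rightarrow> ennreal (\<kappa> y z)). \<forall>\<^sub>F m in sequentially. l < h m w"
    using conv
  proof eventually_elim
    case (elim w)
    obtain y z where w: "w = (y, z)" by (cases w)
    show ?case
    proof (intro allI impI)
      fix l :: ennreal assume "l < (case w of (y, z) \<Rightarrow> ennreal (\<kappa> y z))"
      then have l: "l < ennreal (\<kappa> y z)" by (simp add: w)
      then obtain l0 where l0: "l = ennreal l0" "0 \<le> l0"
        by (metis ennreal_cases top.not_eq_extremum order_less_trans ennreal_less_top)
      \<comment> \<open>An intermediate value, because \<open>c_ge\<close> yields only a weak
        inequality and Fatou needs a strict one.\<close>
      define l1 where "l1 = (l0 + \<kappa> y z) / 2"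
      have l1: "l0 < l1" "l1 < \<kappa> y z"
        using l l0 by (auto simp: l1_def ennreal_less_iff)
      have "\<exists>N. \<forall>n\<in>I. n \<ge> N \<longrightarrow> (\<forall>y' z'. dist y y' < 1 / real (Suc N) \<longrightarrow> dist z z' < 1 / real (Suc N) \<longrightarrow> l1 \<le> \<kappa>s n y' z')"
        using elim by (intro kernels_ge_near[OF _ l1(2)]) (simp add: w)
      then obtain N where N: "\<And>n y' z'. n \<in> I \<Longrightarrow> N \<le> n \<Longrightarrow> dist y y' < 1 / real (Suc N) \<Longrightarrow> dist z z' < 1 / real (Suc N) \<Longrightarrow> l1 \<le> \<kappa>s n y' z'"
        by blast
      have "\<forall>\<^sub>F m in sequentially. l1 \<le> c m (q m y) (q m z)"
        by (rule c_ge[of N]) (rule N)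
      then show "\<forall>\<^sub>F m in sequentially. l < h m w"
        by eventually_elim (use l1 l0 in \<open>auto simp: w h_def ennreal_less_iff\<close>)
    qed
  qed
  moreover have "ennreal a < (\<integral>\<^sup>+ (y, z). ennreal (\<kappa> y z) \<partial>(\<mu> \<Otimes>\<^sub>M \<mu>))"
    using a by (simp add: int_eq[symmetric] ennreal_less_iff)
  ultimately have "\<exists>m. ennreal a < (\<integral>\<^sup>+ w. h m w \<partial>(\<mu> \<Otimes>\<^sub>M \<mu>))"
    by (rule exists_nn_integral_greater[OF h_meas])
  then obtain m where m: "ennreal a < (\<integral>\<^sup>+ w. h m w \<partial>(\<mu> \<Otimes>\<^sub>M \<mu>))" ..
  \<comment> \<open>\<open>g K\<close> is \<open>h m\<close> restricted to the first
    \<open>K\<close> cells in each coordinate; at each point it equals \<open>h m\<close> as soon as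
    \<open>K\<close> exceeds both labels.\<close>
  define g where "g = (\<lambda>K w. \<Sum>i<K. \<Sum>j<K. ennreal (c m i j) * indicator ({y. q m y = i} \<times> {z. q m z = j}) w)"
  have g_eq: "g K (y, z) = (if q m y < K \<and> q m z < K then h m (y, z) else 0)" for K y z
  proof -
    have "g K (y, z) = (\<Sum>i<K. \<Sum>j<K. if i = q m y then (if j = q m z then ennreal (c m i j) else 0) else 0)"
      unfolding g_def by (intro sum.cong refl) (auto simp: indicator_def)
    also have "\<dots> = (\<Sum>i<K. if i = q m y then (\<Sum>j<K. if j = q m z then ennreal (c m i j) else 0) else 0)"
      by (intro sum.cong refl) auto
    finally show ?thesis by (simp add: h_def)
  qed
  have sets: "{y. q m y = i} \<times> {z. q m z = j} \<in> sets (\<mu> \<Otimes>\<^sub>M \<mu>)" for i j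
    using cell_sets by (intro pair_measureI)
  have [measurable]: "g K \<in> borel_measurable (\<mu> \<Otimes>\<^sub>M \<mu>)" for K
    unfolding g_def using sets by measurable
  have "\<forall>l < h m w. \<forall>\<^sub>F K in sequentially. l < g K w" for w
  proof (cases w)
    case (Pair y z)
    have "\<forall>\<^sub>F K in sequentially. q m y < K \<and> q m z < K"
      by (intro eventually_conj eventually_gt_at_top)
    then have "\<forall>\<^sub>F K in sequentially. g K w = h m w"
      by eventually_elim (simp add: Pair g_eq)
    then show ?thesis
      by (auto elim: eventually_mono)
  qed
  with exists_nn_integral_greater[of g "\<mu> \<Otimes>\<^sub>M \<mu>" "h m", OF _ _ m]
  obtain K where K: "ennreal a < (\<integral>\<^sup>+ w. g K w \<partial>(\<mu> \<Otimes>\<^sub>M \<mu>))"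
    by auto
  also have "(\<integral>\<^sup>+ w. g K w \<partial>(\<mu> \<Otimes>\<^sub>M \<mu>))
      = (\<Sum>i<K. \<Sum>j<K. ennreal (c m i j) * emeasure (\<mu> \<Otimes>\<^sub>M \<mu>) ({y. q m y = i} \<times> {z. q m z = j}))"
    unfolding g_def using sets
    by (simp add: nn_integral_sum nn_integral_cmult_indicator del: sum_mult_indicator sum_indicator_mult)
  also have "\<dots> = (\<Sum>i<K. \<Sum>j<K. ennreal (c m i j * (measure \<mu> {y. q m y = i} * measure \<mu> {y. q m y = j})))"
    by (intro sum.cong refl)
      (simp add: emeasure_pair_measure_Times cell_sets emeasure_eq_measure ennreal_mult' c_nn)
  also have "\<dots> = ennreal (\<Sum>i<K. \<Sum>j<K. c m i j * (measure \<mu> {y. q m y = i} * measure \<mu> {y. q m y = j}))"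
    by (simp add: sum_ennreal c_nn sum_nonneg)
  finally have "a < (\<Sum>i<K. \<Sum>j<K. c m i j * (measure \<mu> {y. q m y = i} * measure \<mu> {y. q m y = j}))"
    using a(1) by (simp add: ennreal_less_iff)
  then show ?thesis
    using that[of "q m" "c m" m K] q(1) c_nn c_le c_le_\<kappa> by blast
qed

section \<open>Conditional lower tail and mean of the number of edges\<close>

text \<open>Exponential Markov inequality: the indicator of \<open>X < a\<close> is at most
  \<open>exp (t * a - t * X)\<close>. By independence the expectation of
  \<open>exp (- t * X)\<close> is a product, and each factor is estimated by
  \<open>1 - u \<le> exp (- u)\<close>.\<close>

lemma bernoulli_count_lower_tail:
  fixes p :: "'e \<Rightarrow> real"
  assumes A: "finite A" and p: "\<And>e. e \<in> A \<Longrightarrow> 0 \<le> p e \<and> p e \<le> 1" and "0 \<le> t"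
  shows "measure_pmf.prob (map_pmf (\<lambda>b. {e \<in> A. b e}) (Pi_pmf A False (\<lambda>e. bernoulli_pmf (p e))))
           {S. real (card S) < a} \<le> exp (t * a - (1 - exp (- t)) * sum p A)"
proof -
  define Q where "Q = Pi_pmf A False (\<lambda>e. bernoulli_pmf (p e))"
  define X where "X = (\<lambda>b. real (card {e \<in> A. b e}))"
  have "finite (set_pmf Q)"
    unfolding Q_def by (rule finite_subset[OF set_Pi_pmf_subset'[OF A]]) (use A in \<open>auto intro: finite_PiE_dflt\<close>)
  then have int: "integrable (measure_pmf Q) (h :: _ \<Rightarrow> real)" for h
    by (rule integrable_measure_pmf_finite)
  have "measure_pmf.prob (map_pmf (\<lambda>b. {e \<in> A. b e}) Q) {S. real (card S) < a} = measure_pmf.prob Q {b. X b < a}"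
    by (simp add: X_def vimage_def)
  also have "\<dots> = measure_pmf.expectation Q (indicator {b. X b < a})"
    by simp
  also have "\<dots> \<le> measure_pmf.expectation Q (\<lambda>b. exp (t * a) * exp (- t * X b))"
    using \<open>0 \<le> t\<close> by (intro integral_mono int)
      (auto simp: indicator_def exp_add[symmetric] right_diff_distrib[symmetric] mult_left_mono less_imp_le)
  also have "\<dots> = exp (t * a) * measure_pmf.expectation Q (\<lambda>b. exp (- t * X b))"
    by simp
  also have "(\<lambda>b. exp (- t * X b)) = (\<lambda>b. \<Prod>e\<in>A. (if b e then exp (- t) else 1))"
  proof
    fix b
    have "X b = (\<Sum>e\<in>A. if b e then 1 else 0)"
      using A by (simp add: X_def sum.If_cases Int_def)
    then have "- t * X b = (\<Sum>e\<in>A. if b e then - t else 0)"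
      by (simp add: sum_distrib_left if_distrib cong: if_cong)
    then show "exp (- t * X b) = (\<Prod>e\<in>A. (if b e then exp (- t) else 1))"
      using A by (simp add: exp_sum if_distrib cong: if_cong)
  qed
  also have "measure_pmf.expectation Q (\<lambda>b. \<Prod>e\<in>A. (if b e then exp (- t) else 1))
    = (\<Prod>e\<in>A. measure_pmf.expectation (bernoulli_pmf (p e)) (\<lambda>c. if c then exp (- t) else 1))"
    unfolding Q_def by (intro expectation_prod_Pi_pmf[OF A]) (auto intro: integrable_measure_pmf_finite)
  also have "\<dots> = (\<Prod>e\<in>A. 1 - (1 - exp (- t)) * p e)"
    using p by (intro prod.cong refl) (simp add: algebra_simps)
  also have "\<dots> \<le> (\<Prod>e\<in>A. exp (- ((1 - exp (- t)) * p e)))"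
  proof (intro prod_mono conjI)
    fix e assume e: "e \<in> A"
    show "0 \<le> 1 - (1 - exp (- t)) * p e"
      using p[OF e] \<open>0 \<le> t\<close> mult_le_one[of "1 - exp (-t)" "p e"] by simp
    show "1 - (1 - exp (- t)) * p e \<le> exp (- ((1 - exp (- t)) * p e))"
      using exp_ge_add_one_self[of "- ((1 - exp (- t)) * p e)"] by simp
  qed
  also have "\<dots> = exp (- ((1 - exp (- t)) * sum p A))"
    using A by (simp add: exp_sum[symmetric] sum_negf sum_distrib_left)
  finally show ?thesis
    by (simp add: Q_def exp_add[symmetric])
qed

text \<open>The exponent of the preceding tail bound, per vertex, is negative for small
  \<open>t > 0\<close>, since its derivative at 0 is \<open>a - b < 0\<close>.\<close>

lemma chernoff_rate:
  fixes a b :: real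
  assumes "0 < a" "a < b"
  obtains t \<delta> where "0 \<le> t" "0 < \<delta>" "\<delta> \<le> (1 - exp (- t)) * b - t * a"
proof
  \<comment> \<open>With this choice \<open>a * (1 + t)\<close> is the midpoint of \<open>a\<close>
    and \<open>b\<close>. Since \<open>1 - exp (- t) \<ge> t / (1 + t)\<close>, the rate
    \<open>t * (b / (1 + t) - a)\<close> is admissible and positive.\<close>
  define t where "t = (b - a) / (2 * a)"
  show "0 \<le> t" using assms by (simp add: t_def)
  have t: "0 < t" using assms by (simp add: t_def)
  have "exp (- t) \<le> 1 / (1 + t)"
    using exp_ge_add_one_self[of t] t by (simp add: exp_minus inverse_eq_divide frac_le)
  then have "t / (1 + t) \<le> 1 - exp (- t)"
    using t by (simp add: field_simps)
  then have "t / (1 + t) * b \<le> (1 - exp (- t)) * b"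
    using assms by (intro mult_right_mono) auto
  then show "t / (1 + t) * b - t * a \<le> (1 - exp (- t)) * b - t * a"
    by simp
  have "a * (1 + t) < b"
    using assms by (simp add: t_def field_simps)
  then have "a < b / (1 + t)" using t by (simp add: field_simps)
  then have "t * a < t * (b / (1 + t))" using t by (rule mult_strict_left_mono)
  then show "0 < t / (1 + t) * b - t * a" by simp
qed

lemma finite_possible_edges: "finite (possible_edges n)"
  by (rule finite_subset[of _ "{1..n} \<times> {1..n}"]) (auto simp: possible_edges_def)

text \<open>The conditional expectation of the number of edges given the points
  \<open>s\<close>.\<close>

definition mean_edges :: "nat \<Rightarrow> ('a \<Rightarrow> 'a \<Rightarrow> real) \<Rightarrow> (nat \<Rightarrow> 'a) \<Rightarrow> real" where
  "mean_edges n \<kappa> s = (\<Sum>(i, j)\<in>possible_edges n. min (\<kappa> (s i) (s j) / real n) 1)"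

text \<open>The rate \<open>\<delta>\<close> depends only on \<open>a\<close> and \<open>b\<close>,
  not on \<open>n\<close>, the kernel or the points, so the bound can be integrated over the random
  points.\<close>

lemma graph_pmf_lower_tail:
  fixes a b :: real
  assumes "0 < a" "a < b"
  obtains \<delta> where "0 < \<delta>"
    "\<And>n \<kappa> s. (\<And>y z. 0 \<le> \<kappa> y z) \<Longrightarrow> real n * b \<le> mean_edges n \<kappa> s \<Longrightarrow>
       measure_pmf.prob (graph_pmf n \<kappa> s) {G. real (card G) < real n * a} \<le> exp (- \<delta> * real n)"
proof -
  obtain t \<delta> where t: "0 \<le> t" "0 < \<delta>" "\<delta> \<le> (1 - exp (- t)) * b - t * a"
    using chernoff_rate[OF assms] by blast
  show thesis
  proof (rule that[OF t(2)])
    fix n and \<kappa> :: "'a \<Rightarrow> 'a \<Rightarrow> real" and s :: "nat \<Rightarrow> 'a"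
    assume nn: "\<And>y z. 0 \<le> \<kappa> y z" and m: "real n * b \<le> mean_edges n \<kappa> s"
    define p where "p = (\<lambda>(i, j). min (\<kappa> (s i) (s j) / real n) 1)"
    have "measure_pmf.prob (graph_pmf n \<kappa> s) {G. real (card G) < real n * a}
        \<le> exp (t * (real n * a) - (1 - exp (- t)) * sum p (possible_edges n))"
      using bernoulli_count_lower_tail[OF finite_possible_edges[of n] _ t(1), of p "real n * a"] nn
      by (auto simp: graph_pmf_def p_def case_prod_unfold)
    also have "\<dots> \<le> exp (- \<delta> * real n)"
    proof -
      have "(1 - exp (- t)) * (real n * b) \<le> (1 - exp (- t)) * sum p (possible_edges n)"
        using m t(1) by (intro mult_left_mono) (auto simp: mean_edges_def p_def)
      moreover have "real n * \<delta> \<le> real n * ((1 - exp (- t)) * b - t * a)"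
        using t(3) by (intro mult_left_mono) auto
      ultimately show ?thesis by (simp add: algebra_simps)
    qed
    finally show "measure_pmf.prob (graph_pmf n \<kappa> s) {G. real (card G) < real n * a} \<le> exp (- \<delta> * real n)" .
  qed
qed

section \<open>Measurability of the conditional law in the random points\<close>

lemma measurable_kernel_compose:
  fixes X Y :: "'w \<Rightarrow> 'a::{metric_space, second_countable_topology}"
  assumes "is_kernel \<kappa>" "X \<in> borel_measurable M" "Y \<in> borel_measurable M"
  shows "(\<lambda>\<omega>. \<kappa> (X \<omega>) (Y \<omega>)) \<in> borel_measurable M"
proof -
  have "(\<lambda>\<omega>. (X \<omega>, Y \<omega>)) \<in> borel_measurable M"
    using assms(2,3) by (rule borel_measurable_Pair)
  moreover have "(\<lambda>(y, z). \<kappa> y z) \<in> borel_measurable borel"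
    using assms(1) by (simp add: is_kernel_def)
  ultimately have "(\<lambda>\<omega>. case (X \<omega>, Y \<omega>) of (y, z) \<Rightarrow> \<kappa> y z) \<in> borel_measurable M"
    by (rule measurable_compose)
  then show ?thesis by simp
qed

lemma set_pmf_graph_pmf: "G \<in> set_pmf (graph_pmf n \<kappa> s) \<Longrightarrow> G \<subseteq> possible_edges n"
  by (auto simp: graph_pmf_def)

text \<open>Makes the mixture in \<open>random_graph\<close> a genuine bind of a measurable kernel.
  The probability of any set of graphs is a finite sum of products of edge probabilities, each
  measurable in \<open>\<omega>\<close>.\<close>

lemma measurable_graph_pmf:
  fixes X :: "nat \<Rightarrow> 'w \<Rightarrow> 'a::{metric_space, second_countable_topology}"
  assumes \<kappa>: "is_kernel \<kappa>" and X: "\<And>i. i \<in> {1..n} \<Longrightarrow> X i \<in> borel_measurable M"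
  shows "(\<lambda>\<omega>. measure_pmf (graph_pmf n \<kappa> (\<lambda>i. X i \<omega>))) \<in> measurable M (subprob_algebra (count_space UNIV))"
proof (rule measurable_subprob_algebra)
  fix A :: "(nat \<times> nat) set set"
  define E where "E = possible_edges n"
  \<comment> \<open>\<open>Pi_pmf\<close> gives no mass to configurations that differ from the
    default \<open>False\<close> outside \<open>E\<close>; the finitely many others carry the whole
    probability.\<close>
  define B :: "(nat \<times> nat \<Rightarrow> bool) set" where "B = PiE_dflt E False (\<lambda>_. UNIV) \<inter> {b. {e \<in> E. b e} \<in> A}"
  define p where "p = (\<lambda>\<omega> (i, j). min (\<kappa> (X i \<omega>) (X j \<omega>) / real n) 1)"
  have p: "0 \<le> p \<omega> e \<and> p \<omega> e \<le> 1" for \<omega> e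
    using \<kappa> by (auto simp: p_def is_kernel_def split: prod.splits)
  have finE: "finite E" unfolding E_def by (rule finite_possible_edges)
  have finB: "finite B"
    unfolding B_def using finE by (intro finite_Int disjI1 finite_PiE_dflt) auto
  have eq: "emeasure (measure_pmf (graph_pmf n \<kappa> (\<lambda>i. X i \<omega>))) A
      = ennreal (\<Sum>b\<in>B. \<Prod>e\<in>E. if b e then p \<omega> e else 1 - p \<omega> e)" for \<omega>
  proof -
    define Q where "Q = Pi_pmf E False (\<lambda>e. bernoulli_pmf (p \<omega> e))"
    have "graph_pmf n \<kappa> (\<lambda>i. X i \<omega>) = map_pmf (\<lambda>b. {e \<in> E. b e}) Q"
      by (simp add: graph_pmf_def Q_def E_def p_def case_prod_unfold)
    then have "emeasure (measure_pmf (graph_pmf n \<kappa> (\<lambda>i. X i \<omega>))) A = emeasure (measure_pmf Q) {b. {e \<in> E. b e} \<in> A}"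
      by (simp add: vimage_def)
    also have "\<dots> = emeasure (measure_pmf Q) B"
    proof (rule emeasure_eq_AE)
      show "AE b in measure_pmf Q. b \<in> {b. {e \<in> E. b e} \<in> A} \<longleftrightarrow> b \<in> B"
        using set_Pi_pmf_subset'[OF finE, of False "\<lambda>e. bernoulli_pmf (p \<omega> e)"]
        by (intro AE_pmfI) (auto simp: B_def Q_def PiE_dflt_def)
    qed auto
    also have "\<dots> = ennreal (\<Sum>b\<in>B. pmf Q b)"
      by (simp add: measure_pmf.emeasure_eq_measure measure_measure_pmf_finite[OF finB])
    also have "(\<Sum>b\<in>B. pmf Q b) = (\<Sum>b\<in>B. \<Prod>e\<in>E. if b e then p \<omega> e else 1 - p \<omega> e)"
    proof (rule sum.cong[OF refl])
      fix b assume "b \<in> B"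
      then have "pmf Q b = (\<Prod>e\<in>E. pmf (bernoulli_pmf (p \<omega> e)) (b e))"
        unfolding Q_def by (intro pmf_Pi'[OF finE]) (auto simp: B_def PiE_dflt_def)
      also have "\<dots> = (\<Prod>e\<in>E. if b e then p \<omega> e else 1 - p \<omega> e)"
        using p by (intro prod.cong refl) (auto simp: pmf_bernoulli_True pmf_bernoulli_False)
      finally show "pmf Q b = (\<Prod>e\<in>E. if b e then p \<omega> e else 1 - p \<omega> e)" .
    qed
    finally show ?thesis .
  qed
  have pm: "(\<lambda>\<omega>. p \<omega> e) \<in> borel_measurable M" if "e \<in> E" for e
  proof -
    obtain i j where e: "e = (i, j)" by (cases e)
    have "(\<lambda>\<omega>. \<kappa> (X i \<omega>) (X j \<omega>)) \<in> borel_measurable M"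
      using that by (intro measurable_kernel_compose[OF \<kappa>] X) (auto simp: e E_def possible_edges_def)
    then show ?thesis by (simp add: e p_def)
  qed
  have "(\<lambda>\<omega>. if b e then p \<omega> e else 1 - p \<omega> e) \<in> borel_measurable M" if "e \<in> E" for b e
    using pm[OF that] by (cases "b e") simp_all
  then show "(\<lambda>\<omega>. emeasure (measure_pmf (graph_pmf n \<kappa> (\<lambda>i. X i \<omega>))) A) \<in> borel_measurable M"
    unfolding eq
    by (intro measurable_compose[OF _ measurable_ennreal] borel_measurable_sum borel_measurable_prod)
qed (auto intro: measure_pmf.subprob_space_axioms)

section \<open>Comparison of the conditional mean with a step function\<close>

lemma sum_sum_eq_2_mean_edges:
  assumes "\<And>y z. \<kappa> y z = \<kappa> z y"
  shows "2 * mean_edges n \<kappa> s = (\<Sum>k\<in>{1..n}. \<Sum>l\<in>{1..n} - {k}. min (\<kappa> (s k) (s l) / real n) 1)"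
proof -
  define p where "p = (\<lambda>(k, l). min (\<kappa> (s k) (s l) / real n) 1)"
  have sym: "p (k, l) = p (l, k)" for k l
    using assms by (simp add: p_def)
  \<comment> \<open>The mirror images of the possible edges; together they exhaust the ordered pairs
    of distinct vertices.\<close>
  define E' where "E' = {(k, l). 1 \<le> l \<and> l < k \<and> k \<le> n}"
  have "sum p E' = sum p (possible_edges n)"
    by (rule sum.reindex_bij_witness[of _ prod.swap prod.swap])
      (auto simp: E'_def possible_edges_def sym)
  moreover have "finite E'"
    by (rule finite_subset[of _ "{1..n} \<times> {1..n}"]) (auto simp: E'_def)
  moreover have "possible_edges n \<inter> E' = {}"
    by (auto simp: possible_edges_def E'_def)
  ultimately have "2 * sum p (possible_edges n) = sum p (possible_edges n \<union> E')"
    by (simp add: sum.union_disjoint finite_possible_edges)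
  also have "possible_edges n \<union> E' = Sigma {1..n} (\<lambda>k. {1..n} - {k})"
    by (auto simp: possible_edges_def E'_def)
  also have "sum p \<dots> = (\<Sum>k\<in>{1..n}. \<Sum>l\<in>{1..n} - {k}. p (k, l))"
    by (subst sum.Sigma) auto
  finally show ?thesis
    by (simp add: mean_edges_def p_def)
qed

text \<open>Expanding the frequencies \<open>\<nu> i * \<nu> j\<close> turns the sum over cells into
  a sum over ordered pairs of vertices. The \<open>n\<close> diagonal pairs have no edge; after
  division by \<open>n\<close> they cost at most \<open>m\<close>. For the other pairs,
  \<open>c \<le> m \<le> n\<close> keeps \<open>c / n\<close> below the truncation at 1.\<close>

lemma mean_edges_ge_step:
  fixes s :: "nat \<Rightarrow> 'a" and q :: "'a \<Rightarrow> nat" and c :: "nat \<Rightarrow> nat \<Rightarrow> real"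
  assumes sym: "\<And>y z. \<kappa> y z = \<kappa> z y"
    and c: "\<And>i j. 0 \<le> c i j" "\<And>i j. c i j \<le> real m" "\<And>y z. c (q y) (q z) \<le> \<kappa> y z"
    and n: "0 < n" "m \<le> n"
  defines "\<nu> \<equiv> \<lambda>i. real (card {k \<in> {1..n}. s k \<in> {y. q y = i}}) / real n"
  shows "real n * (\<Sum>i<K. \<Sum>j<K. c i j * (\<nu> i * \<nu> j)) - real m \<le> 2 * mean_edges n \<kappa> s"
proof -
  define t where "t = (\<lambda>k. q (s k))"
  define N :: "nat \<Rightarrow> real" where "N = (\<lambda>i. \<Sum>k=1..n. if t k = i then 1 else 0)"
  have \<nu>: "\<nu> i = N i / real n" for i
    by (simp add: \<nu>_def N_def t_def sum.If_cases Int_def)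
  have "real n * (\<Sum>i<K. \<Sum>j<K. c i j * (\<nu> i * \<nu> j))
     = (\<Sum>i<K. \<Sum>j<K. c i j * (N i * N j)) / real n"
    using n unfolding \<nu> sum_distrib_left sum_divide_distrib by (intro sum.cong refl) (simp add: field_simps)
  also have "(\<Sum>i<K. \<Sum>j<K. c i j * (N i * N j))
     = (\<Sum>i<K. \<Sum>j<K. \<Sum>k=1..n. \<Sum>l=1..n. if i = t k then if j = t l then c i j else 0 else 0)"
    unfolding N_def sum_product unfolding sum_distrib_left by (intro sum.cong refl) auto
  also have "\<dots> = (\<Sum>k=1..n. \<Sum>l=1..n. \<Sum>i<K. \<Sum>j<K. if i = t k then if j = t l then c i j else 0 else 0)"
    by (simp only: sum.swap[of _ "{1..n}" "{..<K}"])
  also have "\<dots> = (\<Sum>k=1..n. \<Sum>l=1..n. \<Sum>i<K. if i = t k then (\<Sum>j<K. if j = t l then c i j else 0) else 0)"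
    by (intro sum.cong refl) auto
  \<comment> \<open>Only an inequality: the left side omits points in cells with label at least
    \<open>K\<close>, and \<open>c\<close> is nonnegative.\<close>
  also have "\<dots> \<le> (\<Sum>k=1..n. \<Sum>l=1..n. c (t k) (t l))"
    by (intro sum_mono) (auto simp: c)
  also have "\<dots> = (\<Sum>k=1..n. c (t k) (t k) + (\<Sum>l\<in>{1..n} - {k}. c (t k) (t l)))"
    by (intro sum.cong refl) (simp add: sum.remove)
  also have "\<dots> \<le> (\<Sum>k=1..n. real m + (\<Sum>l\<in>{1..n} - {k}. c (t k) (t l)))"
    by (intro sum_mono add_right_mono c)
  also have "\<dots> = real n * real m + (\<Sum>k=1..n. \<Sum>l\<in>{1..n} - {k}. c (t k) (t l))"
    by (simp add: sum.distrib)
  finally have "real n * (\<Sum>i<K. \<Sum>j<K. c i j * (\<nu> i * \<nu> j))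
     \<le> (real n * real m + (\<Sum>k=1..n. \<Sum>l\<in>{1..n} - {k}. c (t k) (t l))) / real n"
    using n by (simp add: divide_right_mono)
  also have "\<dots> = real m + (\<Sum>k=1..n. \<Sum>l\<in>{1..n} - {k}. c (t k) (t l) / real n)"
    using n by (simp add: add_divide_distrib sum_divide_distrib)
  also have "(\<Sum>k=1..n. \<Sum>l\<in>{1..n} - {k}. c (t k) (t l) / real n)
     \<le> (\<Sum>k=1..n. \<Sum>l\<in>{1..n} - {k}. min (\<kappa> (s k) (s l) / real n) 1)"
  proof (intro sum_mono min.boundedI)
    fix k l
    show "c (t k) (t l) / real n \<le> \<kappa> (s k) (s l) / real n"
      using c(3) by (simp add: t_def divide_right_mono)
    show "c (t k) (t l) / real n \<le> 1"
      using c(2)[of "t k" "t l"] n by (simp add: divide_le_eq)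
  qed
  also have "\<dots> = 2 * mean_edges n \<kappa> s"
    by (rule sum_sum_eq_2_mean_edges[OF sym, symmetric])
  finally show ?thesis by simp
qed

section \<open>Convergence in probability\<close>

lemma tendsto_in_prob_if_lower_tail:
  fixes M :: "nat \<Rightarrow> 'b measure" and X :: "nat \<Rightarrow> 'b \<Rightarrow> real"
  assumes M: "\<And>n. n \<in> I \<Longrightarrow> prob_space (M n)"
    and int: "\<And>n. n \<in> I \<Longrightarrow> integrable (M n) (X n)"
    and nn: "\<And>n w. n \<in> I \<Longrightarrow> 0 \<le> X n w" and "0 \<le> c"
    and mean: "((\<lambda>n. integral\<^sup>L (M n) (X n)) \<longlongrightarrow> c) (at_infinity_in I)"
    and low: "\<And>a. a < c \<Longrightarrow> ((\<lambda>n. measure (M n) {w \<in> space (M n). X n w < a}) \<longlongrightarrow> 0) (at_infinity_in I)"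
  shows "tendsto_in_prob I M X c"
  unfolding tendsto_in_prob_def
proof (intro allI impI tendstoI)
  fix \<epsilon> \<tau> :: real assume "0 < \<epsilon>" "0 < \<tau>"
  define L where "L = (\<lambda>a n. measure (M n) {w \<in> space (M n). X n w < a})"
  \<comment> \<open>Three error terms of size at most \<open>d\<close> will give
    \<open>\<epsilon> * measure (M n) H < 3 * d\<close>, so the upper deviation costs
    \<open>3 * \<tau> / 4\<close> and leaves \<open>\<tau> / 4\<close> for the lower one.\<close>
  define d where "d = \<epsilon> * \<tau> / 4"
  have "0 < d" using \<open>0 < \<epsilon>\<close> \<open>0 < \<tau>\<close> by (simp add: d_def)
  have in_I: "\<forall>\<^sub>F n in at_infinity_in I. n \<in> I"
    unfolding at_infinity_in_def eventually_inf_principal by simp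
  have e1: "\<forall>\<^sub>F n in at_infinity_in I. L (c - \<epsilon>) n < \<tau> / 4"
    using low[of "c - \<epsilon>"] \<open>0 < \<epsilon>\<close> \<open>0 < \<tau>\<close> unfolding L_def by (intro order_tendstoD(2)[of _ 0]) auto
  have e2: "\<forall>\<^sub>F n in at_infinity_in I. c * L (c - d) n < d"
  proof (rule order_tendstoD(2)[OF _ \<open>0 < d\<close>])
    show "((\<lambda>n. c * L (c - d) n) \<longlongrightarrow> 0) (at_infinity_in I)"
      using low[of "c - d"] \<open>0 < d\<close> unfolding L_def by (intro tendsto_mult_right_zero) auto
  qed
  have e3: "\<forall>\<^sub>F n in at_infinity_in I. integral\<^sup>L (M n) (X n) < c + d"
    using mean \<open>0 < d\<close> by (intro order_tendstoD(2)) auto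
  show "\<forall>\<^sub>F n in at_infinity_in I. dist (measure (M n) {w \<in> space (M n). \<epsilon> < \<bar>X n w - c\<bar>}) 0 < \<tau>"
    using in_I e1 e2 e3
  proof eventually_elim
    case (elim n)
    interpret prob_space "M n" using M elim by simp
    note [measurable] = borel_measurable_integrable[OF int[OF elim(1)]]
    define H where "H = {w \<in> space (M n). c + \<epsilon> < X n w}"
    define S where "S = {w \<in> space (M n). X n w < c - d}"
    have [measurable]: "H \<in> sets (M n)" "{w \<in> space (M n). X n w < a} \<in> sets (M n)" for a
      unfolding H_def by measurable
    then have "S \<in> sets (M n)" unfolding S_def by blast
    then have ind: "integrable (M n) (indicat_real H)" "integrable (M n) (indicat_real S)"
      by (intro integrable_real_indicator; simp add: less_top[symmetric])+
    note int = int[OF elim(1)] ind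
    have "\<epsilon> * measure (M n) H = (\<integral>w. \<epsilon> * indicator H w \<partial>M n)"
      by simp
    \<comment> \<open>Pointwise: off \<open>S\<close> the quantity \<open>X - c + d\<close> is
      nonnegative, and on \<open>H\<close> it exceeds \<open>\<epsilon>\<close>; on
      \<open>S\<close>, which is disjoint from \<open>H\<close>, the added \<open>c\<close>
      compensates because \<open>X \<ge> 0\<close>.\<close>
    also have "\<dots> \<le> (\<integral>w. X n w - c + d + c * indicator S w \<partial>M n)"
    proof (rule integral_mono)
      show "integrable (M n) (\<lambda>w. X n w - c + d + c * indicator S w)"
        using int by simp
      fix w assume "w \<in> space (M n)"
      then show "\<epsilon> * indicator H w \<le> X n w - c + d + c * indicator S w"
        using nn[OF elim(1), of w] \<open>0 \<le> c\<close> \<open>0 < d\<close> \<open>0 < \<epsilon>\<close> by (auto simp: H_def S_def indicator_def)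
    qed (use int in simp)
    also have "\<dots> = integral\<^sup>L (M n) (X n) - c + d + c * L (c - d) n"
      using int \<open>S \<in> sets (M n)\<close> by (simp add: L_def S_def[symmetric] prob_space)
    also have "\<dots> < 3 * d" using elim by simp
    finally have "measure (M n) H < 3 * \<tau> / 4"
      using \<open>0 < \<epsilon>\<close> by (simp add: d_def field_simps)
    moreover have "measure (M n) {w \<in> space (M n). \<epsilon> < \<bar>X n w - c\<bar>} \<le> measure (M n) (H \<union> {w \<in> space (M n). X n w < c - \<epsilon>})"
      by (rule finite_measure_mono) (auto simp: H_def)
    moreover have "\<dots> \<le> measure (M n) H + L (c - \<epsilon>) n"
      unfolding L_def by (rule measure_Un_le) measurable
    ultimately show ?case using elim by (simp add: dist_real_def)
  qed
qed

text \<open>If all cell frequencies are close to their limits, the conditional mean is at least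
  \<open>n * b\<close> with \<open>b > a\<close>, and the Chernoff bound applies. The remaining
  event is covered by finitely many events \<open>Bad n i\<close> of vanishing probability.\<close>

lemma (in vertex_space) edges_lower_tail:
  fixes \<kappa>s :: "nat \<Rightarrow> 'a \<Rightarrow> 'a \<Rightarrow> real" and \<kappa> :: "'a \<Rightarrow> 'a \<Rightarrow> real"
  assumes gr: "graphical \<mu> I P x \<kappa>s \<kappa>" and a: "a < kernel_integral \<mu> \<kappa> / 2"
  shows "((\<lambda>n. measure (random_graph P x n (\<kappa>s n)) {G. real (card G) / real n < a}) \<longlongrightarrow> 0) (at_infinity_in I)"
proof (cases "0 < a")
  case False
  then have "{G :: (nat \<times> nat) set. real (card G) / real n < a} = {}" for n
    by (auto simp: not_less intro: order_trans[of a 0])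
  then show ?thesis by simp
next
  case True
  have \<kappa>s: "\<And>n. n \<in> I \<Longrightarrow> is_kernel (\<kappa>s n)" and \<kappa>: "is_kernel \<kappa>"
    using gr by (auto simp: graphical_def)
  have \<kappa>s_nn: "\<forall>n\<in>I. \<forall>y z. 0 \<le> \<kappa>s n y z" and \<kappa>_nn: "\<And>y z. 0 \<le> \<kappa> y z"
    using \<kappa>s \<kappa> by (auto simp: is_kernel_def)
  have conv: "AE (y, z) in \<mu> \<Otimes>\<^sub>M \<mu>. \<forall>ys zs.
        (ys \<longlongrightarrow> y) (at_infinity_in I) \<longrightarrow> (zs \<longlongrightarrow> z) (at_infinity_in I) \<longrightarrow>
        ((\<lambda>n. \<kappa>s n (ys n) (zs n)) \<longlongrightarrow> \<kappa> y z) (at_infinity_in I)"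
    and int: "integrable (\<mu> \<Otimes>\<^sub>M \<mu>) (\<lambda>(y, z). \<kappa> y z)"
    using gr by (simp_all add: graphical_def)
  \<comment> \<open>The chain \<open>2 * a < 2 * b < a2 < S\<close> leaves one gap per loss:
    fluctuation around the conditional mean, diagonal terms, and empirical error. The gap from
    \<open>a2\<close> up to the integral of \<open>\<kappa>\<close> pays for the step
    function.\<close>
  define a2 where "a2 = (2 * a + kernel_integral \<mu> \<kappa>) / 2"
  have a2: "2 * a < a2" "a2 < kernel_integral \<mu> \<kappa>" "0 \<le> a2"
    using a True by (auto simp: a2_def)
  obtain q :: "'a \<Rightarrow> nat" and c :: "nat \<Rightarrow> nat \<Rightarrow> real" and m K :: nat where q: "\<And>k. continuity_set \<mu> {y. q y = k}"
    and c: "\<And>i j. 0 \<le> c i j" "\<And>i j. c i j \<le> real m"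
      "\<And>n y z. n \<in> I \<Longrightarrow> m \<le> n \<Longrightarrow> c (q y) (q z) \<le> \<kappa>s n y z"
    and S: "a2 < (\<Sum>i<K. \<Sum>j<K. c i j * (measure \<mu> {y. q y = i} * measure \<mu> {y. q y = j}))"
    by (fact exists_step_minorant[OF \<kappa>s_nn conv int \<kappa>_nn a2(3) a2(2)])
  define S where "S = (\<Sum>i<K. \<Sum>j<K. c i j * (measure \<mu> {y. q y = i} * measure \<mu> {y. q y = j}))"
  define \<nu> where "\<nu> = (\<lambda>n \<omega> i. real (card {k \<in> {1..n}. x n k \<omega> \<in> {y. q y = i}}) / real n)"
  define D where "D = real K * real K * real m"
  have "0 \<le> D" by (simp add: D_def)
  \<comment> \<open>Each of the \<open>K * K\<close> products of frequencies is off by at most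
    \<open>2 * \<eta>\<close>, with weight at most \<open>m\<close>, so the total error
    \<open>2 * D * \<eta>\<close> fits into \<open>S - a2\<close>. The \<open>+ 1\<close> covers
    \<open>D = 0\<close>.\<close>
  define \<eta> where "\<eta> = (S - a2) / (2 * (D + 1))"
  have \<eta>: "0 < \<eta>" "2 * D * \<eta> \<le> S - a2"
    using S \<open>0 \<le> D\<close> by (simp_all add: \<eta>_def S_def[symmetric] divide_simps mult_left_mono)
  define b where "b = (2 * a + a2) / 4"
  have b: "a < b" "2 * b < a2" using a2 by (auto simp: b_def)
  obtain \<delta> where \<delta>: "0 < \<delta>"
    "\<And>n \<kappa> (s :: nat \<Rightarrow> 'a). (\<And>y z. 0 \<le> \<kappa> y z) \<Longrightarrow> real n * b \<le> mean_edges n \<kappa> s \<Longrightarrow>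
       measure_pmf.prob (graph_pmf n \<kappa> s) {G. real (card G) < real n * a} \<le> exp (- \<delta> * real n)"
    using graph_pmf_lower_tail[OF True b(1)] by blast
  define Bad where "Bad = (\<lambda>n i. {\<omega> \<in> space (P n). \<eta> < \<bar>\<nu> n \<omega> i - measure \<mu> {y. q y = i}\<bar>})"
  have Bad_lim: "((\<lambda>n. measure (P n) (Bad n i)) \<longlongrightarrow> 0) (at_infinity_in I)" for i
    using empirical_tendsto[OF q[of i]] \<eta>(1)
    unfolding tendsto_in_prob_def Bad_def \<nu>_def by blast
  have exp_lim: "((\<lambda>n. exp (- \<delta> * real n)) \<longlongrightarrow> 0) (at_infinity_in I)"
  proof (rule tendsto_mono)
    show "at_infinity_in I \<le> sequentially" by (simp add: at_infinity_in_def)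
    show "(\<lambda>n. exp (- \<delta> * real n)) \<longlonglongrightarrow> 0" using \<delta>(1) by real_asymp
  qed
  define U where "U = (\<lambda>n. (\<Sum>i<K. measure (P n) (Bad n i)) + exp (- \<delta> * real n))"
  have U_lim: "(U \<longlongrightarrow> 0) (at_infinity_in I)"
    unfolding U_def using tendsto_add[OF tendsto_sum[OF Bad_lim] exp_lim, of "\<lambda>i. i" "{..<K}"]
    by simp
  \<comment> \<open>From here on the diagonal loss \<open>m\<close> is at most
    \<open>n * (a2 - 2 * b)\<close>.\<close>
  define N where "N = nat \<lceil>real m / (a2 - 2 * b)\<rceil>"
  have bound: "measure (random_graph P x n (\<kappa>s n)) {G. real (card G) / real n < a} \<le> U n"
    if n: "n \<in> I" "max m N \<le> n" for n
  proof -
    interpret P: prob_space "P n" using prob_space_P n(1) .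
    have n0: "0 < n" using index_pos n(1) .
    have nn: "0 \<le> \<kappa>s n y z" for y z using \<kappa>s[OF n(1)] by (simp add: is_kernel_def)
    have meas: "(\<lambda>\<omega>. measure_pmf (graph_pmf n (\<kappa>s n) (\<lambda>i. x n i \<omega>))) \<in> measurable (P n) (subprob_algebra (count_space UNIV))"
      by (rule measurable_graph_pmf[OF \<kappa>s[OF n(1)] random_points[OF n(1)]])
    have Bad_sets: "Bad n i \<in> sets (P n)" for i
    proof -
      have [measurable]: "x n k \<in> measurable (P n) borel" if "k \<in> {1..n}" for k
        using random_points[OF n(1) that] .
      have [measurable]: "{y. q y = i} \<in> sets borel" using q[of i] by (simp add: continuity_set_def)
      have "\<nu> n \<omega> i = (\<Sum>k=1..n. indicator {y. q y = i} (x n k \<omega>)) / real n" for \<omega>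
        by (simp add: \<nu>_def indicator_def sum.If_cases Int_def)
      moreover have "(\<lambda>\<omega>. (\<Sum>k=1..n. indicator {y. q y = i} (x n k \<omega>)) / real n) \<in> borel_measurable (P n)"
        by measurable
      ultimately have [measurable]: "(\<lambda>\<omega>. \<nu> n \<omega> i) \<in> borel_measurable (P n)" by simp
      show ?thesis unfolding Bad_def by measurable
    qed
    have good: "measure (graph_pmf n (\<kappa>s n) (\<lambda>i. x n i \<omega>)) {G. real (card G) / real n < a} \<le> exp (- \<delta> * real n)"
      if \<omega>: "\<omega> \<in> space (P n)" "\<And>i. i < K \<Longrightarrow> \<omega> \<notin> Bad n i" for \<omega>
    proof -
      have \<nu>_close: "\<bar>\<nu> n \<omega> i - measure \<mu> {y. q y = i}\<bar> \<le> \<eta>" if "i < K" for i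
        using \<omega>(1) \<omega>(2)[OF that] by (simp add: Bad_def)
      have \<nu>_bounds: "0 \<le> \<nu> n \<omega> i" "\<nu> n \<omega> i \<le> 1" for i
      proof -
        have "card {k \<in> {1..n}. x n k \<omega> \<in> {y. q y = i}} \<le> card {1..n}" by (intro card_mono) auto
        then show "\<nu> n \<omega> i \<le> 1" using n0 by (simp add: \<nu>_def)
      qed (simp add: \<nu>_def)
      have term_ge: "c i j * (measure \<mu> {y. q y = i} * measure \<mu> {y. q y = j}) - real m * (2 * \<eta>) \<le> c i j * (\<nu> n \<omega> i * \<nu> n \<omega> j)"
        if "i < K" "j < K" for i j
      proof -
        let ?u = "measure \<mu> {y. q y = i}" and ?v = "measure \<mu> {y. q y = j}"
        have "?u * ?v - \<nu> n \<omega> i * \<nu> n \<omega> j = (?u - \<nu> n \<omega> i) * ?v + \<nu> n \<omega> i * (?v - \<nu> n \<omega> j)"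
          by (simp add: algebra_simps)
        also have "\<dots> \<le> \<eta> * ?v + \<nu> n \<omega> i * \<eta>"
          using \<nu>_close[OF that(1)] \<nu>_close[OF that(2)] \<nu>_bounds
          by (intro add_mono mult_right_mono mult_left_mono) auto
        also have "\<dots> \<le> \<eta> * 1 + 1 * \<eta>"
          using \<nu>_bounds \<eta>(1) by (intro add_mono mult_right_mono mult_left_mono) auto
        finally have "?u * ?v - \<nu> n \<omega> i * \<nu> n \<omega> j \<le> 2 * \<eta>" by simp
        then have "c i j * (?u * ?v - \<nu> n \<omega> i * \<nu> n \<omega> j) \<le> c i j * (2 * \<eta>)"
          using c(1) by (rule mult_left_mono)
        also have "\<dots> \<le> real m * (2 * \<eta>)" using c(2) \<eta>(1) by (intro mult_right_mono) auto
        finally show ?thesis by (simp add: algebra_simps)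
      qed
      have "S - real K * real K * (real m * (2 * \<eta>))
         = (\<Sum>i<K. \<Sum>j<K. c i j * (measure \<mu> {y. q y = i} * measure \<mu> {y. q y = j}) - real m * (2 * \<eta>))"
        by (simp add: S_def sum_subtractf)
      also have "\<dots> \<le> (\<Sum>i<K. \<Sum>j<K. c i j * (\<nu> n \<omega> i * \<nu> n \<omega> j))"
        by (intro sum_mono term_ge) auto
      finally have "a2 \<le> (\<Sum>i<K. \<Sum>j<K. c i j * (\<nu> n \<omega> i * \<nu> n \<omega> j))"
        using \<eta>(2) by (simp add: D_def algebra_simps)
      then have "real n * a2 \<le> real n * (\<Sum>i<K. \<Sum>j<K. c i j * (\<nu> n \<omega> i * \<nu> n \<omega> j))"
        by (intro mult_left_mono) auto
      also have "\<dots> - real m \<le> 2 * mean_edges n (\<kappa>s n) (\<lambda>k. x n k \<omega>)"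
        unfolding \<nu>_def using n n0 c \<kappa>s[OF n(1)]
        by (intro mean_edges_ge_step) (auto simp: is_kernel_def)
      finally have "real n * a2 - real m \<le> 2 * mean_edges n (\<kappa>s n) (\<lambda>k. x n k \<omega>)" by simp
      moreover have "real m \<le> real n * (a2 - 2 * b)"
      proof -
        have "real m / (a2 - 2 * b) \<le> real n" using n(2) by (simp add: N_def)
        then show ?thesis using b(2) by (simp add: field_simps)
      qed
      ultimately have "real n * b \<le> mean_edges n (\<kappa>s n) (\<lambda>k. x n k \<omega>)"
        by (simp add: algebra_simps)
      from \<delta>(2)[OF nn this] show ?thesis
        using n0 by (simp add: divide_less_eq mult.commute)
    qed
    have "measure (random_graph P x n (\<kappa>s n)) {G. real (card G) / real n < a}
        = (\<integral>\<omega>. measure (graph_pmf n (\<kappa>s n) (\<lambda>i. x n i \<omega>)) {G. real (card G) / real n < a} \<partial>P n)"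
      unfolding random_graph_def by (rule P.measure_bind[OF meas]) simp
    \<comment> \<open>A union bound in integrated form: on a bad event the conditional probability
      is at most 1, elsewhere at most the exponential.\<close>
    also have "\<dots> \<le> (\<integral>\<omega>. (\<Sum>i<K. indicator (Bad n i) \<omega>) + exp (- \<delta> * real n) \<partial>P n)"
    proof (rule integral_mono')
      show "integrable (P n) (\<lambda>\<omega>. (\<Sum>i<K. indicator (Bad n i) \<omega>) + exp (- \<delta> * real n))"
        using Bad_sets by (intro Bochner_Integration.integrable_add Bochner_Integration.integrable_sum integrable_real_indicator)
          (auto simp: less_top[symmetric])
      fix \<omega> assume \<omega>: "\<omega> \<in> space (P n)"
      show "measure (graph_pmf n (\<kappa>s n) (\<lambda>i. x n i \<omega>)) {G. real (card G) / real n < a}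
        \<le> (\<Sum>i<K. indicator (Bad n i) \<omega>) + exp (- \<delta> * real n)"
      proof (cases "\<exists>i<K. \<omega> \<in> Bad n i")
        case True
        then obtain i where i: "i < K" "\<omega> \<in> Bad n i" by blast
        have "1 = indicat_real (Bad n i) \<omega>" using i by simp
        also have "\<dots> \<le> (\<Sum>i<K. indicat_real (Bad n i) \<omega>)"
          using i by (intro member_le_sum) auto
        finally have "1 \<le> (\<Sum>i<K. indicat_real (Bad n i) \<omega>)" .
        moreover have "measure (graph_pmf n (\<kappa>s n) (\<lambda>i. x n i \<omega>)) {G. real (card G) / real n < a} \<le> 1"
          by (rule measure_pmf.prob_le_1)
        moreover have "0 \<le> exp (- \<delta> * real n)"
          by simp
        ultimately show ?thesis
          by linarith
      next
        case False
        then have "measure (graph_pmf n (\<kappa>s n) (\<lambda>i. x n i \<omega>)) {G. real (card G) / real n < a} \<le> exp (- \<delta> * real n)"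
          using good[OF \<omega>] by blast
        then show ?thesis by (rule order_trans) (simp add: sum_nonneg)
      qed
    qed (simp_all add: sum_nonneg)
    also have "\<dots> = U n"
      using Bad_sets by (simp add: U_def integrable_real_indicator less_top[symmetric] P.prob_space)
    finally show ?thesis .
  qed
  have "\<forall>\<^sub>F n in at_infinity_in I. n \<in> I \<and> max m N \<le> n"
    unfolding at_infinity_in_def eventually_inf_principal
    using eventually_ge_at_top[of "max m N"] by eventually_elim simp
  then have "\<forall>\<^sub>F n in at_infinity_in I. measure (random_graph P x n (\<kappa>s n)) {G. real (card G) / real n < a} \<le> U n"
    by eventually_elim (use bound in blast)
  then show ?thesis
    by (intro tendsto_sandwich[OF _ _ tendsto_const U_lim]) auto
qed

text \<open>The mass sits on subsets of the finite set \<open>possible_edges n\<close>, so the edge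
  count is almost surely bounded and hence integrable.\<close>

lemma (in vertex_space)
  assumes "is_kernel \<kappa>" "n \<in> I"
  shows space_random_graph: "space (random_graph P x n \<kappa>) = UNIV"
    and prob_space_random_graph: "prob_space (random_graph P x n \<kappa>)"
    and integrable_edges: "integrable (random_graph P x n \<kappa>) (\<lambda>G. real (card G) / real n)"
proof -
  interpret P: prob_space "P n" using prob_space_P assms(2) .
  have meas: "(\<lambda>\<omega>. measure_pmf (graph_pmf n \<kappa> (\<lambda>i. x n i \<omega>))) \<in> measurable (P n) (subprob_algebra (count_space UNIV))"
    by (rule measurable_graph_pmf[OF assms(1) random_points[OF assms(2)]])
  have sets: "sets (random_graph P x n \<kappa>) = UNIV"
    unfolding random_graph_def using P.not_empty sets_kernel[OF meas] by (subst sets_bind) auto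
  show "space (random_graph P x n \<kappa>) = UNIV"
    using sets_eq_imp_space_eq[of _ "count_space UNIV"] sets by simp
  show pr: "prob_space (random_graph P x n \<kappa>)"
    unfolding random_graph_def
    by (rule P.prob_space_bind[OF _ meas]) (simp add: measure_pmf.prob_space_axioms)
  then interpret R: prob_space "random_graph P x n \<kappa>" .
  have "AE G in random_graph P x n \<kappa>. G \<subseteq> possible_edges n"
    unfolding random_graph_def
    by (subst AE_bind[OF meas]) (auto intro!: AE_pmfI dest: set_pmf_graph_pmf)
  then have "AE G in random_graph P x n \<kappa>. norm (real (card G) / real n) \<le> real (card (possible_edges n)) / real n"
    by eventually_elim (simp add: divide_right_mono card_mono finite_possible_edges)
  then show "integrable (random_graph P x n \<kappa>) (\<lambda>G. real (card G) / real n)"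
    by (rule R.integrable_const_bound) (simp add: measurable_def sets)
qed

section \<open>The integral of a critical kernel\<close>

lemma (in ground_space) kernel_integral_critical:
  fixes \<kappa> :: "'a \<Rightarrow> 'a \<Rightarrow> real"
  assumes \<kappa>: "is_kernel \<kappa>" and int: "integrable (\<mu> \<Otimes>\<^sub>M \<mu>) (\<lambda>(y, z). \<kappa> y z)"
    and "critical \<mu> \<kappa>"
  shows "kernel_integral \<mu> \<kappa> \<le> 1"
    and "kernel_integral \<mu> \<kappa> = 1 \<longleftrightarrow> (AE y in \<mu>. (LINT z|\<mu>. \<kappa> y z) = 1)"
proof -
  interpret pair: pair_prob_space \<mu> \<mu> ..
  have \<kappa>_nn: "0 \<le> \<kappa> y z" for y z using \<kappa> by (simp add: is_kernel_def)
  define g where "g = (\<lambda>y. LINT z|\<mu>. \<kappa> y z)"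
  have g_int: "integrable \<mu> g"
    using pair.integrable_fst'[OF int] by (simp add: g_def)
  have g_eq: "integral\<^sup>L \<mu> g = kernel_integral \<mu> \<kappa>"
    using pair.integral_fst'[OF int] by (simp add: g_def kernel_integral_def)
  have g_nn: "0 \<le> g y" for y unfolding g_def by (simp add: \<kappa>_nn)
  define s where "s = (\<integral>\<^sup>+ y. (T_op \<mu> \<kappa> (\<lambda>_. 1) y)\<^sup>2 \<partial>\<mu>)"
  \<comment> \<open>The constant 1 is an admissible test function because \<open>\<mu>\<close> has
    total mass 1.\<close>
  have "L2_norm \<mu> (\<lambda>y. ennreal 1) \<le> 1"
    by (simp add: L2_norm_def emeasure_space_1)
  then have "L2_norm \<mu> (T_op \<mu> \<kappa> (\<lambda>_. 1)) \<le> T_norm \<mu> \<kappa>"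
    unfolding T_norm_def by (intro Sup_upper CollectI exI[of _ "\<lambda>_. 1"]) auto
  also have "\<dots> = 1" using assms(3) by (simp add: critical_def)
  finally have L: "L2_norm \<mu> (T_op \<mu> \<kappa> (\<lambda>_. 1)) \<le> 1" .
  then have "s \<noteq> \<infinity>"
    by (auto simp: L2_norm_def s_def[symmetric] top_unique)
  then have "enn2real s \<le> 1"
    using L by (simp add: L2_norm_def s_def[symmetric] ennreal_le_1)
  moreover have "s = ennreal (enn2real s)"
    using \<open>s \<noteq> \<infinity>\<close> by (simp add: less_top)
  ultimately have s: "s \<le> 1" by (metis ennreal_le_1)
  \<comment> \<open>The Bochner integral \<open>g y\<close> agrees with the extended-valued
    \<open>T_op\<close> where the section of \<open>\<kappa>\<close> is integrable, which by Fubini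
    is almost everywhere.\<close>
  have "AE y in \<mu>. T_op \<mu> \<kappa> (\<lambda>_. 1) y = ennreal (g y)"
    using pair.AE_integrable_fst'[OF int]
    by eventually_elim (simp add: T_op_def g_def nn_integral_eq_integral \<kappa>_nn)
  then have "(\<integral>\<^sup>+ y. ennreal ((g y)\<^sup>2) \<partial>\<mu>) = s"
    unfolding s_def by (intro nn_integral_cong_AE, eventually_elim) (simp add: ennreal_power g_nn)
  with s have nn_le: "(\<integral>\<^sup>+ y. ennreal ((g y)\<^sup>2) \<partial>\<mu>) \<le> 1" by simp
  have g2_int: "integrable \<mu> (\<lambda>y. (g y)\<^sup>2)"
    using nn_le borel_measurable_integrable[OF g_int]
    by (intro integrableI_bounded) (auto simp: le_less_trans[OF _ ennreal_one_less_top])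
  have g2_le: "(\<integral>y. (g y)\<^sup>2 \<partial>\<mu>) \<le> 1"
    using nn_le nn_integral_eq_integral[OF g2_int] by simp
  have var_int: "integrable \<mu> (\<lambda>y. (g y - 1)\<^sup>2)"
    using g_int g2_int by (simp add: power2_diff)
  \<comment> \<open>As the left side is nonnegative and the integral of the square of
    \<open>g\<close> is at most 1, this gives the bound; in the equality case it forces the left
    side to be 0, hence \<open>g = 1\<close> almost everywhere.\<close>
  have var: "(\<integral>y. (g y - 1)\<^sup>2 \<partial>\<mu>) = (\<integral>y. (g y)\<^sup>2 \<partial>\<mu>) + 1 - 2 * kernel_integral \<mu> \<kappa>"
    using g_int g2_int by (simp add: power2_diff g_eq[symmetric] prob_space)
  moreover have var_nn: "0 \<le> (\<integral>y. (g y - 1)\<^sup>2 \<partial>\<mu>)" by simp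
  ultimately show "kernel_integral \<mu> \<kappa> \<le> 1" using g2_le by linarith
  show "kernel_integral \<mu> \<kappa> = 1 \<longleftrightarrow> (AE y in \<mu>. (LINT z|\<mu>. \<kappa> y z) = 1)"
  proof
    assume "kernel_integral \<mu> \<kappa> = 1"
    with var var_nn g2_le have "(\<integral>y. (g y - 1)\<^sup>2 \<partial>\<mu>) = 0" by linarith
    then have "AE y in \<mu>. (g y - 1)\<^sup>2 = 0"
      using integral_nonneg_eq_0_iff_AE[OF var_int] by simp
    then show "AE y in \<mu>. (LINT z|\<mu>. \<kappa> y z) = 1" by (simp add: g_def)
  next
    assume "AE y in \<mu>. (LINT z|\<mu>. \<kappa> y z) = 1"
    then have "integral\<^sup>L \<mu> g = (\<integral>y. 1 \<partial>\<mu>)"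
      using borel_measurable_integrable[OF g_int] by (intro integral_cong_AE) (auto simp: g_def)
    then show "kernel_integral \<mu> \<kappa> = 1" by (simp add: g_eq prob_space)
  qed
qed

theorem proposition3p4:
  fixes \<mu> :: "'a::{metric_space, second_countable_topology} measure"
    and I :: "nat set"
    and P :: "nat \<Rightarrow> 'w measure"
    and x :: "nat \<Rightarrow> nat \<Rightarrow> 'w \<Rightarrow> 'a"
    and \<kappa>s :: "nat \<Rightarrow> 'a \<Rightarrow> 'a \<Rightarrow> real"
    and \<kappa> :: "'a \<Rightarrow> 'a \<Rightarrow> real"
  assumes "vertex_space \<mu> I P x"
    and "graphical \<mu> I P x \<kappa>s \<kappa>"
    and "critical \<mu> \<kappa>"
  shows "tendsto_in_prob I (\<lambda>n. random_graph P x n (\<kappa>s n)) (\<lambda>n G. real (card G) / real n)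
           (kernel_integral \<mu> \<kappa> / 2)
       \<and> kernel_integral \<mu> \<kappa> / 2 \<le> 1 / 2
       \<and> (\<kappa> = (\<lambda>_ _. 1) \<longrightarrow> kernel_integral \<mu> \<kappa> / 2 = 1 / 2)
       \<and> (kernel_integral \<mu> \<kappa> / 2 = 1 / 2 \<longleftrightarrow> (AE y in \<mu>. (LINT z|\<mu>. \<kappa> y z) = 1))"
proof -
  interpret vertex_space \<mu> I P x by fact
  have \<kappa>s: "\<And>n. n \<in> I \<Longrightarrow> is_kernel (\<kappa>s n)" and \<kappa>: "is_kernel \<kappa>"
    and int: "integrable (\<mu> \<Otimes>\<^sub>M \<mu>) (\<lambda>(y, z). \<kappa> y z)"
    and mean: "((\<lambda>n. (LINT G|random_graph P x n (\<kappa>s n). real (card G)) / real n)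
        \<longlongrightarrow> kernel_integral \<mu> \<kappa> / 2) (at_infinity_in I)"
    using assms(2) by (auto simp: graphical_def)
  have "0 \<le> kernel_integral \<mu> \<kappa>"
    unfolding kernel_integral_def using \<kappa> by (intro integral_nonneg_AE) (auto simp: is_kernel_def)
  moreover have "((\<lambda>n. measure (random_graph P x n (\<kappa>s n))
      {G \<in> space (random_graph P x n (\<kappa>s n)). real (card G) / real n < a}) \<longlongrightarrow> 0) (at_infinity_in I)"
    if "a < kernel_integral \<mu> \<kappa> / 2" for a
  \<comment> \<open>The space of the random graph is known to be the whole type only for
    \<open>n\<close> in \<open>I\<close>, so the two events are identified eventually along the
    filter.\<close>
  proof (rule Lim_transform_eventually[OF edges_lower_tail[OF assms(2) that]])
    have "\<forall>\<^sub>F n in at_infinity_in I. n \<in> I"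
      by (simp add: at_infinity_in_def eventually_inf_principal)
    then show "\<forall>\<^sub>F n in at_infinity_in I. measure (random_graph P x n (\<kappa>s n)) {G. real (card G) / real n < a}
      = measure (random_graph P x n (\<kappa>s n)) {G \<in> space (random_graph P x n (\<kappa>s n)). real (card G) / real n < a}"
      by eventually_elim (simp add: space_random_graph \<kappa>s)
  qed
  ultimately have "tendsto_in_prob I (\<lambda>n. random_graph P x n (\<kappa>s n)) (\<lambda>n G. real (card G) / real n)
           (kernel_integral \<mu> \<kappa> / 2)"
    using mean by (intro tendsto_in_prob_if_lower_tail)
      (simp_all add: prob_space_random_graph integrable_edges \<kappa>s)
  moreover have "kernel_integral \<mu> \<kappa> = 1" if "\<kappa> = (\<lambda>_ _. 1)"
    using kernel_integral_critical(2)[OF \<kappa> int assms(3)] that by (simp add: prob_space)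
  ultimately show ?thesis
    using kernel_integral_critical[OF \<kappa> int assms(3)] by simp
qed

end
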